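(* Let $G$ be a Lie group of dimension $n$ with Lie algebra $\mathfrak{g}$, let $g_0$ be a left invariant Riemannian metric on $G$, and let $\{E_i\}_{i=1}^n$ be a frame of $\mathfrak{g}$ orthonormal with respect to $g_0$, with structure constants $C=(C^k_{ij})$, $[E_i,E_j]=\sum_k C^k_{ij}E_k$. Let $Q(t)$ be a smooth curve in $GL(n)=GL(n,\mathbb{R})$, and write $$Q(t)=B(t)U(t),$$ where $B(t)$ is a smooth curve in the group $UT(n)$ of invertible upper triangular matrices and $U(t)$ is a smooth curve in the group $O(n)$ of orthogonal matrices. Then $Q(t)$ is a solution of the Ricci flow system $(\ast)$ (the system of ordinary differential equations defined in the context) if and only if $B(t)$ is a solution of $(\ast)$ (that is, of the same system with $Q$ replaced by $B$ throughout).
   Context: For a matrix $P=(P^i_j)\in GL(n)$ (upper index = row, lower index = column) with inverse $(\widetilde P^i_j)$, put $$C^k_{ij}[P]=\sum_{s,m,l}P^s_iP^m_jC^l_{sm}\widetilde P^k_l,$$ the structure constants of $\mathfrak{g}$ with respect to the frame $\sum_jP^j_iE_j$, and $$R_{jk}[P]=\sum_{s,m}\Big(-\tfrac12 C^s_{mj}[P]C^m_{sk}[P]+\tfrac14 C^j_{ms}[P]C^k_{ms}[P]-\tfrac12 C^s_{mj}[P]C^s_{mk}[P]+\tfrac12 C^m_{ms}[P]\big(C^k_{sj}[P]+C^j_{sk}[P]\big)\Big),$$ the coordinates of the Ricci tensor of the left invariant metric for which the frame $\sum_j P^j_iE_j$ is orthonormal, with respect to this frame. A smooth curve $P(t)$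 in $GL(n)$ is called a solution of $(\ast)$ if for all $i,j$ and all $t$ $$(\ast)\qquad \sum_s\widetilde P^j_s(t)\dot P^s_i(t)+\sum_s\widetilde P^i_s(t)\dot P^s_j(t)=2R_{ij}[P(t)],$$ where the dot denotes $d/dt$. *)

theory Defs
  imports "HOL-Analysis.Analysis"
begin

section \<open>Smooth maps between Euclidean spaces\<close>

text \<open>
  A map is smooth on \<open>S\<close> if it has iterated directional derivatives of all orders there and
  each of them is Frechet differentiable: \<open>D [v\<^sub>k, \<dots>, v\<^sub>1] x\<close> is the derivative of \<open>f\<close> at \<open>x\<close>, taken
  first in direction \<open>v\<^sub>1\<close> and last in direction \<open>v\<^sub>k\<close>.  The definition is used for open sets \<open>S\<close>
  and for nondegenerate intervals of the real line (with one-sided derivatives at end points).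
\<close>

definition smooth_on :: "'a::euclidean_space set \<Rightarrow> ('a \<Rightarrow> 'b::real_normed_vector) \<Rightarrow> bool" where
  "smooth_on S f \<longleftrightarrow>
     (\<exists>D :: 'a list \<Rightarrow> 'a \<Rightarrow> 'b.
        (\<forall>x\<in>S. D [] x = f x) \<and>
        (\<forall>vs. \<forall>x\<in>S. (D vs has_derivative (\<lambda>v. D (v # vs) x)) (at x within S)))"


section \<open>Manifolds, tangent vectors and vector fields\<close>

text \<open>A chart is a pair of a coordinate domain and a coordinate map; the value of the coordinate map
  outside of the domain is irrelevant.\<close>

type_synonym ('g, 'n) chart = "'g set \<times> ('g \<Rightarrow> real ^ 'n)"

text \<open>The dimension of the manifold is \<open>CARD('n)\<close>; its points are all elements of \<open>'g\<close>, and its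
  topology is that of \<open>'g\<close>.\<close>

definition smooth_atlas ::
  "('g::{t2_space, second_countable_topology}, 'n::finite) chart set \<Rightarrow> bool" where
  "smooth_atlas A \<longleftrightarrow>
     (\<Union>(U, \<phi>)\<in>A. U) = UNIV \<and>
     (\<forall>(U, \<phi>)\<in>A. open U \<and> open (\<phi> ` U) \<and> homeomorphism U (\<phi> ` U) \<phi> (inv_into U \<phi>)) \<and>
     (\<forall>(U, \<phi>)\<in>A. \<forall>(V, \<psi>)\<in>A. smooth_on (\<phi> ` (U \<inter> V)) (\<psi> \<circ> inv_into U \<phi>))"

definition smooth_fun :: "('g, 'n::finite) chart set \<Rightarrow> ('g \<Rightarrow> real) \<Rightarrow> bool" where
  "smooth_fun A f \<longleftrightarrow> (\<forall>(U, \<phi>)\<in>A. smooth_on (\<phi> ` U) (f \<circ> inv_into U \<phi>))"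

text \<open>Tangent vectors at \<open>p\<close> are the derivations at \<open>p\<close> of the algebra of smooth functions.  Functions
  in HOL being total, a derivation is given the value 0 on functions that are not smooth, so that it
  is determined by its values on smooth functions.\<close>

definition tangent_space ::
  "('g, 'n::finite) chart set \<Rightarrow> 'g \<Rightarrow> (('g \<Rightarrow> real) \<Rightarrow> real) set" where
  "tangent_space A p =
     {v. (\<forall>f g a b. smooth_fun A f \<longrightarrow> smooth_fun A g \<longrightarrow>
            v (\<lambda>x. a * f x + b * g x) = a * v f + b * v g) \<and>
         (\<forall>f g. smooth_fun A f \<longrightarrow> smooth_fun A g \<longrightarrow>
            v (\<lambda>x. f x * g x) = v f * g p + f p * v g) \<and>
         (\<forall>f. \<not> smooth_fun A f \<longrightarrow> v f = 0)}"

type_synonym 'g vfield = "'g \<Rightarrow> ('g \<Rightarrow> real) \<Rightarrow> real"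

definition smooth_vfield :: "('g, 'n::finite) chart set \<Rightarrow> 'g vfield \<Rightarrow> bool" where
  "smooth_vfield A X \<longleftrightarrow>
     (\<forall>p. X p \<in> tangent_space A p) \<and>
     (\<forall>f. smooth_fun A f \<longrightarrow> smooth_fun A (\<lambda>p. X p f))"

definition lie_bracket :: "'g vfield \<Rightarrow> 'g vfield \<Rightarrow> 'g vfield" where
  "lie_bracket X Y = (\<lambda>p f. X p (\<lambda>q. Y q f) - Y p (\<lambda>q. X q f))"

definition riemannian_metric ::
  "('g, 'n::finite) chart set \<Rightarrow>
   ('g \<Rightarrow> (('g \<Rightarrow> real) \<Rightarrow> real) \<Rightarrow> (('g \<Rightarrow> real) \<Rightarrow> real) \<Rightarrow> real) \<Rightarrow> bool" where
  "riemannian_metric A h \<longleftrightarrow>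
     (\<forall>p. \<forall>u\<in>tangent_space A p. \<forall>v\<in>tangent_space A p. \<forall>w\<in>tangent_space A p. \<forall>a b.
        h p (\<lambda>f. a * u f + b * v f) w = a * h p u w + b * h p v w) \<and>
     (\<forall>p. \<forall>v\<in>tangent_space A p. \<forall>w\<in>tangent_space A p. h p v w = h p w v) \<and>
     (\<forall>p. \<forall>v\<in>tangent_space A p. v \<noteq> (\<lambda>_. 0) \<longrightarrow> h p v v > 0) \<and>
     (\<forall>X Y. smooth_vfield A X \<longrightarrow> smooth_vfield A Y \<longrightarrow>
        smooth_fun A (\<lambda>p. h p (X p) (Y p)))"


section \<open>Lie groups, their Lie algebras and left invariant metrics\<close>

definition lie_group ::
  "('g::{t2_space, second_countable_topology}, 'n::finite) chart set \<Rightarrow>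
   ('g \<Rightarrow> 'g \<Rightarrow> 'g) \<Rightarrow> 'g \<Rightarrow> ('g \<Rightarrow> 'g) \<Rightarrow> bool" where
  "lie_group A mul e iv \<longleftrightarrow>
     smooth_atlas A \<and> group mul e iv \<and>
     continuous_on UNIV (\<lambda>(x, y). mul x y) \<and> continuous_on UNIV iv \<and>
     (\<forall>(U, \<phi>)\<in>A. \<forall>(V, \<psi>)\<in>A. \<forall>(W, \<theta>)\<in>A.
        smooth_on {(\<phi> x, \<psi> y) | x y. x \<in> U \<and> y \<in> V \<and> mul x y \<in> W}
          (\<lambda>(a, b). \<theta> (mul (inv_into U \<phi> a) (inv_into V \<psi> b)))) \<and>
     (\<forall>(U, \<phi>)\<in>A. \<forall>(V, \<psi>)\<in>A.
        smooth_on {\<phi> x | x. x \<in> U \<and> iv x \<in> V} (\<lambda>a. \<psi> (iv (inv_into U \<phi> a))))"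

text \<open>The differential of the left translation by \<open>x\<close>, acting on derivations.\<close>

definition left_push ::
  "('g \<Rightarrow> 'g \<Rightarrow> 'g) \<Rightarrow> 'g \<Rightarrow> (('g \<Rightarrow> real) \<Rightarrow> real) \<Rightarrow> (('g \<Rightarrow> real) \<Rightarrow> real)" where
  "left_push mul x v = (\<lambda>f. v (\<lambda>y. f (mul x y)))"

definition lie_algebra ::
  "('g, 'n::finite) chart set \<Rightarrow> ('g \<Rightarrow> 'g \<Rightarrow> 'g) \<Rightarrow> 'g vfield set" where
  "lie_algebra A mul =
     {X. smooth_vfield A X \<and> (\<forall>x p. X (mul x p) = left_push mul x (X p))}"

definition left_invariant_metric ::
  "('g, 'n::finite) chart set \<Rightarrow> ('g \<Rightarrow> 'g \<Rightarrow> 'g) \<Rightarrow>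
   ('g \<Rightarrow> (('g \<Rightarrow> real) \<Rightarrow> real) \<Rightarrow> (('g \<Rightarrow> real) \<Rightarrow> real) \<Rightarrow> real) \<Rightarrow> bool" where
  "left_invariant_metric A mul h \<longleftrightarrow>
     riemannian_metric A h \<and>
     (\<forall>x p. \<forall>v\<in>tangent_space A p. \<forall>w\<in>tangent_space A p.
        h (mul x p) (left_push mul x v) (left_push mul x w) = h p v w)"

definition orthonormal_frame ::
  "('g, 'n::finite) chart set \<Rightarrow> ('g \<Rightarrow> 'g \<Rightarrow> 'g) \<Rightarrow>
   ('g \<Rightarrow> (('g \<Rightarrow> real) \<Rightarrow> real) \<Rightarrow> (('g \<Rightarrow> real) \<Rightarrow> real) \<Rightarrow> real) \<Rightarrow>
   ('n \<Rightarrow> 'g vfield) \<Rightarrow> bool" where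
  "orthonormal_frame A mul h E \<longleftrightarrow>
     (\<forall>i. E i \<in> lie_algebra A mul) \<and>
     (\<forall>X\<in>lie_algebra A mul. \<exists>c. \<forall>p f. X p f = (\<Sum>i\<in>UNIV. c i * E i p f)) \<and>
     (\<forall>p i j. h p (E i p) (E j p) = (if i = j then 1 else 0))"

text \<open>An array \<open>C\<close> of structure constants is a function with \<open>C k i j\<close> standing for
  \<open>C\<^sup>k\<^sub>i\<^sub>j\<close>, upper index first.\<close>

definition structure_constants ::
  "('n::finite \<Rightarrow> 'g vfield) \<Rightarrow> ('n \<Rightarrow> 'n \<Rightarrow> 'n \<Rightarrow> real) \<Rightarrow> bool" where
  "structure_constants E C \<longleftrightarrow>
     (\<forall>i j p f. lie_bracket (E i) (E j) p f = (\<Sum>k\<in>UNIV. C k i j * E k p f))"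


section \<open>The Ricci flow system\<close>

text \<open>The upper index of a matrix is the row index: \<open>P\<^sup>i\<^sub>j\<close> is \<open>P $ i $ j\<close>.\<close>

definition frame_const ::
  "('n::finite \<Rightarrow> 'n \<Rightarrow> 'n \<Rightarrow> real) \<Rightarrow> real ^ 'n ^ 'n \<Rightarrow> 'n \<Rightarrow> 'n \<Rightarrow> 'n \<Rightarrow> real" where
  "frame_const C P k i j =
     (\<Sum>s\<in>UNIV. \<Sum>m\<in>UNIV. \<Sum>l\<in>UNIV. P $ s $ i * P $ m $ j * C l s m * matrix_inv P $ k $ l)"

definition ricci ::
  "('n::finite \<Rightarrow> 'n \<Rightarrow> 'n \<Rightarrow> real) \<Rightarrow> real ^ 'n ^ 'n \<Rightarrow> 'n \<Rightarrow> 'n \<Rightarrow> real" where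
  "ricci C P j k =
     (let c = frame_const C P in
      \<Sum>s\<in>UNIV. \<Sum>m\<in>UNIV.
        - (1/2) * c s m j * c m s k
        + (1/4) * c j m s * c k m s
        - (1/2) * c s m j * c s m k
        + (1/2) * c m m s * (c k s j + c j s k))"

definition smooth_curve_in ::
  "real set \<Rightarrow> (real ^ 'n::finite ^ 'n) set \<Rightarrow> (real \<Rightarrow> real ^ 'n ^ 'n) \<Rightarrow> bool" where
  "smooth_curve_in T M P \<longleftrightarrow> smooth_on T P \<and> (\<forall>t\<in>T. P t \<in> M)"

definition GL :: "(real ^ 'n::finite ^ 'n) set" where
  "GL = {P. invertible P}"

definition UT :: "(real ^ 'n::{finite, linorder} ^ 'n::{finite, linorder}) set" where
  "UT = {P. invertible P \<and> (\<forall>i j. j < i \<longrightarrow> P $ i $ j = 0)}"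

definition O_group :: "(real ^ 'n::finite ^ 'n) set" where
  "O_group = {P. orthogonal_matrix P}"

definition ricci_flow_solution ::
  "('n::finite \<Rightarrow> 'n \<Rightarrow> 'n \<Rightarrow> real) \<Rightarrow> real set \<Rightarrow> (real \<Rightarrow> real ^ 'n ^ 'n) \<Rightarrow> bool" where
  "ricci_flow_solution C T P \<longleftrightarrow>
     smooth_curve_in T GL P \<and>
     (\<forall>t\<in>T. \<forall>i j.
        (\<Sum>s\<in>UNIV. matrix_inv (P t) $ j $ s * vector_derivative P (at t within T) $ s $ i) +
        (\<Sum>s\<in>UNIV. matrix_inv (P t) $ i $ s * vector_derivative P (at t within T) $ s $ j)
        = 2 * ricci C (P t) i j)"

end

theory Submission
  imports Defs
begin

text \<open>
  Set \<open>S[P] = P\<inverse>P' + (P\<inverse>P')\<^sup>T\<close>.  For \<open>Q = BU\<close> with \<open>U\<close> orthogonal,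
  \<open>Q\<inverse>Q' = U\<^sup>T(B\<inverse>B')U + U\<^sup>TU'\<close>, and \<open>U\<^sup>TU'\<close> is skew because \<open>U\<^sup>TU = 1\<close>; hence
  \<open>S[Q] = U\<^sup>T S[B] U\<close>.  The coordinate formula for the Ricci tensor contracts indices pairwise,
  so it is equivariant under orthogonal changes of frame: \<open>R[BU] = U\<^sup>T R[B] U\<close>.  The two
  systems are therefore conjugate to each other.
\<close>

section \<open>The Ricci tensor under an orthogonal change of frame\<close>

lemma orthogonal_matrix_row_sum:
  fixes U :: "real ^ 'n::finite ^ 'n"
  assumes "orthogonal_matrix U"
  shows "(\<Sum>m\<in>UNIV. U $ a $ m * U $ b $ m) = (if a = b then 1 else 0)"
proof -
  have "(U ** transpose U) $ a $ b = (mat 1 :: real ^ 'n ^ 'n) $ a $ b"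
    using assms by (simp add: orthogonal_matrix_def)
  then show ?thesis
    by (simp add: matrix_matrix_mult_def transpose_def mat_def)
qed

text \<open>Summing over \<open>m\<close> first turns the two entries of \<open>U\<close> into a
  Kronecker delta, since the rows are orthonormal. This invariance of a repeated index underlies
  every later contraction.\<close>

lemma contract_orthogonal:
  fixes U :: "real ^ 'n::finite ^ 'n"
  assumes "orthogonal_matrix U"
  shows "(\<Sum>m\<in>UNIV. (\<Sum>a\<in>UNIV. U $ a $ m * f a) * (\<Sum>b\<in>UNIV. U $ b $ m * g b))
         = (\<Sum>a\<in>UNIV. f a * g a)"
proof -
  have "(\<Sum>m\<in>UNIV. (\<Sum>a\<in>UNIV. U $ a $ m * f a) * (\<Sum>b\<in>UNIV. U $ b $ m * g b))
      = (\<Sum>m\<in>UNIV. \<Sum>a\<in>UNIV. \<Sum>b\<in>UNIV. (U $ a $ m * U $ b $ m) * (f a * g b))"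
    by (simp add: sum_product mult_ac)
  also have "\<dots> = (\<Sum>a\<in>UNIV. \<Sum>b\<in>UNIV. \<Sum>m\<in>UNIV. (U $ a $ m * U $ b $ m) * (f a * g b))"
    by (subst sum.swap, rule sum.cong[OF refl], subst sum.swap, rule refl)
  also have "\<dots> = (\<Sum>a\<in>UNIV. \<Sum>b\<in>UNIV. (if a = b then 1 else 0) * (f a * g b))"
    by (simp add: sum_distrib_right[symmetric] orthogonal_matrix_row_sum[OF assms])
  also have "\<dots> = (\<Sum>a\<in>UNIV. f a * g a)"
    by (simp add: if_distrib[of "\<lambda>x. x * _"] cong: if_cong)
  finally show ?thesis .
qed

lemma contract_orthogonal2:
  fixes U :: "real ^ 'n::finite ^ 'n"
  assumes "orthogonal_matrix U"
  shows "(\<Sum>s\<in>UNIV. \<Sum>m\<in>UNIV.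
            (\<Sum>a\<in>UNIV. U $ a $ s * (\<Sum>b\<in>UNIV. U $ b $ m * F a b)) *
            (\<Sum>a\<in>UNIV. U $ a $ s * (\<Sum>b\<in>UNIV. U $ b $ m * G a b)))
         = (\<Sum>a\<in>UNIV. \<Sum>b\<in>UNIV. F a b * G a b)"
proof -
  have "(\<Sum>s\<in>UNIV. \<Sum>m\<in>UNIV.
            (\<Sum>a\<in>UNIV. U $ a $ s * (\<Sum>b\<in>UNIV. U $ b $ m * F a b)) *
            (\<Sum>a\<in>UNIV. U $ a $ s * (\<Sum>b\<in>UNIV. U $ b $ m * G a b)))
      = (\<Sum>m\<in>UNIV. \<Sum>a\<in>UNIV. (\<Sum>b\<in>UNIV. U $ b $ m * F a b) * (\<Sum>b\<in>UNIV. U $ b $ m * G a b))"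
    by (subst sum.swap) (simp add: contract_orthogonal[OF assms])
  also have "\<dots> = (\<Sum>a\<in>UNIV. \<Sum>b\<in>UNIV. F a b * G a b)"
    by (subst sum.swap) (simp add: contract_orthogonal[OF assms])
  finally show ?thesis .
qed

text \<open>The action of \<open>U\<close> on a tensor with one upper and two lower indices. The
  upper slot should carry the inverse of \<open>U\<close>; for orthogonal \<open>U\<close> that is
  the transpose, so all three slots look alike. Each slot is a separate nested sum, so that slots
  can be permuted and contracted one at a time.\<close>

definition frame_change ::
  "real ^ 'n::finite ^ 'n \<Rightarrow> ('n \<Rightarrow> 'n \<Rightarrow> 'n \<Rightarrow> real) \<Rightarrow> 'n \<Rightarrow> 'n \<Rightarrow> 'n \<Rightarrow> real" where
  "frame_change U c k i j =
     (\<Sum>l\<in>UNIV. U $ l $ k * (\<Sum>s\<in>UNIV. U $ s $ i * (\<Sum>m\<in>UNIV. U $ m $ j * c l s m)))"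

section \<open>Inverses and frame constants of \<open>P ** U\<close>\<close>

lemma matrix_inv_eqI:
  fixes P X :: "real ^ 'n::finite ^ 'n"
  assumes "X ** P = mat 1"
  shows "matrix_inv P = X"
proof -
  have PX: "P ** X = mat 1"
    using assms by (simp add: matrix_left_right_inverse)
  have "P ** matrix_inv P = mat 1 \<and> matrix_inv P ** P = mat 1"
    unfolding matrix_inv_def by (rule someI[of _ X]) (simp add: PX assms)
  then have "matrix_inv P = matrix_inv P ** (P ** X)" and "matrix_inv P ** P = mat 1"
    by (simp_all add: PX)
  then show ?thesis
    by (simp add: matrix_mul_assoc)
qed

lemma matrix_inv_left_inverse:
  fixes P :: "real ^ 'n::finite ^ 'n"
  assumes "invertible P"
  shows "matrix_inv P ** P = mat 1"
proof -
  obtain X where "X ** P = mat 1"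
    using assms by (auto simp: invertible_def)
  then show ?thesis
    using matrix_inv_eqI by metis
qed

lemma matrix_inv_mult_orthogonal:
  fixes P U :: "real ^ 'n::finite ^ 'n"
  assumes "invertible P" "orthogonal_matrix U"
  shows "matrix_inv (P ** U) = transpose U ** matrix_inv P"
proof (rule matrix_inv_eqI)
  have "(transpose U ** matrix_inv P) ** (P ** U) = transpose U ** (matrix_inv P ** P) ** U"
    by (simp add: matrix_mul_assoc)
  then show "(transpose U ** matrix_inv P) ** (P ** U) = mat 1"
    using assms by (simp add: matrix_inv_left_inverse orthogonal_matrix_def)
qed

text \<open>Brings the triple sum into the nested shape of \<open>frame_change\<close>, with the
  upper index outermost.\<close>

lemma frame_const_eq_nested:
  "frame_const C P k i j =
     (\<Sum>l\<in>UNIV. matrix_inv P $ k $ l * (\<Sum>s\<in>UNIV. P $ s $ i * (\<Sum>m\<in>UNIV. P $ m $ j * C l s m)))"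
proof -
  have "frame_const C P k i j = (\<Sum>l\<in>UNIV. \<Sum>s\<in>UNIV. \<Sum>m\<in>UNIV.
      P $ s $ i * P $ m $ j * C l s m * matrix_inv P $ k $ l)"
    unfolding frame_const_def
    by (subst sum.swap, subst (3) sum.swap, subst (2) sum.swap, subst sum.swap, rule refl)
  then show ?thesis
    by (simp add: sum_distrib_left mult_ac)
qed

lemma sum_sum_mult_factor:
  fixes f :: "'n::finite \<Rightarrow> real"
  shows "(\<Sum>l\<in>UNIV. (\<Sum>a\<in>UNIV. f a * g a l) * h l) = (\<Sum>a\<in>UNIV. f a * (\<Sum>l\<in>UNIV. g a l * h l))"
  by (simp add: sum_distrib_left sum_distrib_right mult_ac) (rule sum.swap)

text \<open>Both sides have the same shape, so the later simplifier calls instantiate the factors to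
  fix which sum moves outward.\<close>

lemma sum_mult_swap:
  fixes f g :: "'n::finite \<Rightarrow> real"
  shows "(\<Sum>a\<in>UNIV. f a * (\<Sum>b\<in>UNIV. g b * h a b)) = (\<Sum>b\<in>UNIV. g b * (\<Sum>a\<in>UNIV. f a * h a b))"
  by (simp add: sum_distrib_left mult_ac) (rule sum.swap)

lemma frame_const_mult_orthogonal:
  fixes P U :: "real ^ 'n::finite ^ 'n"
  assumes "invertible P" "orthogonal_matrix U"
  shows "frame_const C (P ** U) = frame_change U (frame_const C P)"
proof (intro ext)
  fix k i j
  let ?X = "matrix_inv P"
  have PU: "(P ** U) $ s $ i = (\<Sum>a\<in>UNIV. U $ a $ i * P $ s $ a)" for s i
    by (simp add: matrix_matrix_mult_def mult_ac)
  have UX: "matrix_inv (P ** U) $ k $ l = (\<Sum>b\<in>UNIV. U $ b $ k * ?X $ b $ l)" for l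
    unfolding matrix_inv_mult_orthogonal[OF assms]
    by (simp add: matrix_matrix_mult_def transpose_def)
  \<comment> \<open>Plain expansion leaves the sums over \<open>U\<close> interleaved with those
    over \<open>P\<close> and its inverse; the next step moves every factor of \<open>U\<close> to
    the outside.\<close>
  have "frame_const C (P ** U) k i j =
      (\<Sum>b\<in>UNIV. U $ b $ k * (\<Sum>l\<in>UNIV. ?X $ b $ l * (\<Sum>a\<in>UNIV. U $ a $ i *
        (\<Sum>s\<in>UNIV. P $ s $ a * (\<Sum>a'\<in>UNIV. U $ a' $ j * (\<Sum>m\<in>UNIV. P $ m $ a' * C l s m))))))"
    by (simp only: frame_const_eq_nested PU UX sum_sum_mult_factor)
  also have "\<dots> = (\<Sum>b\<in>UNIV. U $ b $ k * (\<Sum>a\<in>UNIV. U $ a $ i * (\<Sum>a'\<in>UNIV. U $ a' $ j *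
        (\<Sum>l\<in>UNIV. ?X $ b $ l * (\<Sum>s\<in>UNIV. P $ s $ a * (\<Sum>m\<in>UNIV. P $ m $ a' * C l s m))))))"
    by (simp only: sum_mult_swap[of "\<lambda>l. ?X $ b $ l" "\<lambda>a. U $ a $ i" for b i]
        sum_mult_swap[of "\<lambda>s. P $ s $ a" "\<lambda>a. U $ a $ j" for a j])
  finally show "frame_const C (P ** U) k i j = frame_change U (frame_const C P) k i j"
    by (simp add: frame_change_def frame_const_eq_nested)
qed

section \<open>Quadratic contractions, as bilinear forms under the congruence
  \<open>transpose U ** r ** U\<close>\<close>

definition frame_change2 ::
  "real ^ 'n::finite ^ 'n \<Rightarrow> ('n \<Rightarrow> 'n \<Rightarrow> real) \<Rightarrow> 'n \<Rightarrow> 'n \<Rightarrow> real" where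
  "frame_change2 U r j k = (\<Sum>a\<in>UNIV. U $ a $ j * (\<Sum>b\<in>UNIV. U $ b $ k * r a b))"

lemma frame_change2_linear:
  "frame_change2 U r j k + frame_change2 U r' j k = frame_change2 U (\<lambda>a b. r a b + r' a b) j k"
  "frame_change2 U r j k - frame_change2 U r' j k = frame_change2 U (\<lambda>a b. r a b - r' a b) j k"
  "x * frame_change2 U r j k = frame_change2 U (\<lambda>a b. x * r a b) j k"
  by (simp_all add: frame_change2_def sum.distrib sum_subtractf sum_distrib_left algebra_simps)

lemma sum_sum_linear:
  fixes f :: "'n::finite \<Rightarrow> real"
  shows "(\<Sum>s\<in>UNIV. \<Sum>m\<in>UNIV. (\<Sum>a\<in>UNIV. f a * F a s m) * H s m)
     = (\<Sum>a\<in>UNIV. f a * (\<Sum>s\<in>UNIV. \<Sum>m\<in>UNIV. F a s m * H s m))"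
proof -
  have "(\<Sum>s\<in>UNIV. \<Sum>m\<in>UNIV. (\<Sum>a\<in>UNIV. f a * F a s m) * H s m)
     = (\<Sum>s\<in>UNIV. \<Sum>a\<in>UNIV. f a * (\<Sum>m\<in>UNIV. F a s m * H s m))"
    by (simp only: sum_sum_mult_factor)
  also have "\<dots> = (\<Sum>a\<in>UNIV. \<Sum>s\<in>UNIV. f a * (\<Sum>m\<in>UNIV. F a s m * H s m))"
    by (rule sum.swap)
  finally show ?thesis
    by (simp add: sum_distrib_left)
qed

lemma sum_sum_bilinear:
  fixes f g :: "'n::finite \<Rightarrow> real" and F G :: "'n \<Rightarrow> 'n \<Rightarrow> 'n \<Rightarrow> real"
  shows "(\<Sum>s\<in>UNIV. \<Sum>m\<in>UNIV. (\<Sum>a\<in>UNIV. f a * F a s m) * (\<Sum>b\<in>UNIV. g b * G b s m))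
     = (\<Sum>a\<in>UNIV. f a * (\<Sum>b\<in>UNIV. g b * (\<Sum>s\<in>UNIV. \<Sum>m\<in>UNIV. F a s m * G b s m)))"
  using sum_sum_linear[of g G "F _"] by (simp add: sum_sum_linear mult.commute)

text \<open>The two contracted slots lose their factors of \<open>U\<close> by orthogonality, and
  only the free slots \<open>j\<close> and \<open>k\<close> keep theirs.\<close>

lemma contract_frame_change:
  fixes U :: "real ^ 'n::finite ^ 'n"
  assumes "orthogonal_matrix U"
  shows "(\<Sum>s\<in>UNIV. \<Sum>m\<in>UNIV.
      frame_change U F j s m * frame_change U G k s m)
    = frame_change2 U (\<lambda>a b. \<Sum>s\<in>UNIV. \<Sum>m\<in>UNIV. F a s m * G b s m) j k"
proof -
  \<comment> \<open>The sum for the free slot is pushed innermost, which exposes the two contracted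
    slots to \<open>contract_orthogonal2\<close>.\<close>
  have nest: "frame_change U F j s m = (\<Sum>p\<in>UNIV. U $ p $ s * (\<Sum>q\<in>UNIV. U $ q $ m *
      (\<Sum>a\<in>UNIV. U $ a $ j * F a p q)))" for F j s m
    by (simp only: frame_change_def sum_mult_swap[of "\<lambda>l. U $ l $ j" "\<lambda>a. U $ a $ s"]
        sum_mult_swap[of "\<lambda>l. U $ l $ j" "\<lambda>a. U $ a $ m"])
  show ?thesis
    by (simp only: nest contract_orthogonal2[OF assms] sum_sum_bilinear frame_change2_def)
qed

text \<open>Every slot transforms by the same \<open>U\<close>, so permuting slots commutes with the
  change of frame. This reduces other contraction patterns to the one in
  \<open>contract_frame_change\<close>.\<close>

lemma frame_change_swap_12:
  "frame_change U c k i j = frame_change U (\<lambda>a b d. c b a d) i k j"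
  unfolding frame_change_def by (rule sum_mult_swap)

lemma frame_change_swap_23:
  "frame_change U c k i j = frame_change U (\<lambda>a b d. c a d b) k j i"
  unfolding frame_change_def
  by (rule sum.cong[OF refl], rule arg_cong[where f = "\<lambda>x. _ * x"]) (rule sum_mult_swap)

lemma trace_orthogonal:
  fixes U :: "real ^ 'n::finite ^ 'n"
  assumes "orthogonal_matrix U"
  shows "(\<Sum>m\<in>UNIV. \<Sum>a\<in>UNIV. U $ a $ m * (\<Sum>b\<in>UNIV. U $ b $ m * F a b)) = (\<Sum>a\<in>UNIV. F a a)"
proof -
  \<comment> \<open>For fixed \<open>a\<close>, taking the delta at \<open>a\<close> as first vector
    makes its transform equal to row \<open>a\<close> of \<open>U\<close>.\<close>
  have "(\<Sum>m\<in>UNIV. U $ a $ m * (\<Sum>b\<in>UNIV. U $ b $ m * F a b)) = F a a" for a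
    using contract_orthogonal[OF assms, of "\<lambda>c. if c = a then 1 else 0" "F a"]
    by (simp add: if_distrib[of "\<lambda>x. x * _"] if_distrib[of "\<lambda>x. _ * x"] cong: if_cong)
  then show ?thesis
    by (subst sum.swap) simp
qed

text \<open>Contracting the upper slot with the first lower slot leaves a covector that transforms
  by \<open>U\<close> in its one remaining index.\<close>

lemma trace_frame_change:
  fixes U :: "real ^ 'n::finite ^ 'n"
  assumes "orthogonal_matrix U"
  shows "(\<Sum>m\<in>UNIV. frame_change U c m m s) = (\<Sum>a\<in>UNIV. U $ a $ s * (\<Sum>l\<in>UNIV. c l l a))"
proof -
  have "(\<Sum>m\<in>UNIV. frame_change U c m m s) = (\<Sum>l\<in>UNIV. \<Sum>a\<in>UNIV. U $ a $ s * c l l a)"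
    unfolding frame_change_def by (rule trace_orthogonal[OF assms])
  also have "\<dots> = (\<Sum>a\<in>UNIV. \<Sum>l\<in>UNIV. U $ a $ s * c l l a)"
    by (rule sum.swap)
  finally show ?thesis
    by (simp add: sum_distrib_left)
qed

lemma contract_trace_frame_change:
  fixes U :: "real ^ 'n::finite ^ 'n"
  assumes "orthogonal_matrix U"
  shows "(\<Sum>s\<in>UNIV. \<Sum>m\<in>UNIV. frame_change U c m m s * frame_change U c k s j)
     = frame_change2 U (\<lambda>a b. \<Sum>s\<in>UNIV. \<Sum>m\<in>UNIV. c m m s * c a s b) k j"
proof -
  have "(\<Sum>s\<in>UNIV. \<Sum>m\<in>UNIV. frame_change U c m m s * frame_change U c k s j)
     = (\<Sum>s\<in>UNIV. (\<Sum>a\<in>UNIV. U $ a $ s * (\<Sum>l\<in>UNIV. c l l a)) * frame_change U (\<lambda>a b d. c b a d) s k j)"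
    \<comment> \<open>The slot swap puts the sum for the contracted index \<open>s\<close>
      outermost, as \<open>contract_orthogonal\<close> requires.\<close>
    by (simp only: sum_distrib_right[symmetric] trace_frame_change[OF assms] frame_change_swap_12[of U c k])
  also have "\<dots> = (\<Sum>p\<in>UNIV. (\<Sum>l\<in>UNIV. c l l p) * (\<Sum>a\<in>UNIV. U $ a $ k * (\<Sum>b\<in>UNIV. U $ b $ j * c a p b)))"
    unfolding frame_change_def by (rule contract_orthogonal[OF assms])
  also have "\<dots> = (\<Sum>a\<in>UNIV. U $ a $ k * (\<Sum>b\<in>UNIV. U $ b $ j * (\<Sum>p\<in>UNIV. (\<Sum>l\<in>UNIV. c l l p) * c a p b)))"
    by (simp only: sum_mult_swap[of "\<lambda>p. \<Sum>l\<in>UNIV. c l l p" "\<lambda>a. U $ a $ i" for i])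
  finally show ?thesis
    by (simp add: frame_change2_def sum_distrib_right)
qed

lemma frame_change2_swap: "frame_change2 U r j k = frame_change2 U (\<lambda>a b. r b a) k j"
  unfolding frame_change2_def by (rule sum_mult_swap)

lemma ricci_eq_contractions:
  fixes C P defines "c \<equiv> frame_const C P"
  shows "ricci C P j k =
     - (1/2) * (\<Sum>s\<in>UNIV. \<Sum>m\<in>UNIV. c s m j * c m s k)
     + (1/4) * (\<Sum>s\<in>UNIV. \<Sum>m\<in>UNIV. c j s m * c k s m)
     - (1/2) * (\<Sum>s\<in>UNIV. \<Sum>m\<in>UNIV. c s m j * c s m k)
     + (1/2) * (\<Sum>s\<in>UNIV. \<Sum>m\<in>UNIV. c m m s * c k s j)
     + (1/2) * (\<Sum>s\<in>UNIV. \<Sum>m\<in>UNIV. c m m s * c j s k)"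
proof -
  have "ricci C P j k =
     - (1/2) * (\<Sum>s\<in>UNIV. \<Sum>m\<in>UNIV. c s m j * c m s k)
     + (1/4) * (\<Sum>s\<in>UNIV. \<Sum>m\<in>UNIV. c j m s * c k m s)
     - (1/2) * (\<Sum>s\<in>UNIV. \<Sum>m\<in>UNIV. c s m j * c s m k)
     + (1/2) * (\<Sum>s\<in>UNIV. \<Sum>m\<in>UNIV. c m m s * c k s j)
     + (1/2) * (\<Sum>s\<in>UNIV. \<Sum>m\<in>UNIV. c m m s * c j s k)"
    by (simp add: ricci_def Let_def c_def sum.distrib sum_subtractf sum_negf sum_distrib_left
        distrib_left mult.assoc)
  then show ?thesis
    \<comment> \<open>Exchanges the dummy indices in the term with coefficient 1/4, to match the
      index order of \<open>contract_frame_change\<close>.\<close>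
    by (subst (asm) (2) sum.swap)
qed

lemma ricci_mult_orthogonal:
  fixes P U :: "real ^ 'n::finite ^ 'n"
  assumes "invertible P" and U: "orthogonal_matrix U"
  shows "ricci C (P ** U) j k = frame_change2 U (ricci C P) j k"
proof -
  define c where "c = frame_const C P"
  \<comment> \<open>The free index sits in the last slot here; cycling the slots moves it to the
    front. The primed variant also exchanges \<open>s\<close> and \<open>m\<close>, for the term
    where the two factors carry them in opposite order.\<close>
  have last_first: "frame_change U c s m j = frame_change U (\<lambda>a b d. c b d a) j s m" for s m j
    by (subst frame_change_swap_23, subst frame_change_swap_12, rule refl)
  have last_first': "frame_change U c m s j = frame_change U (\<lambda>a b d. c d b a) j s m" for s m j
    by (subst frame_change_swap_23, subst frame_change_swap_12, subst frame_change_swap_23, rule refl)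
  have 1: "(\<Sum>s\<in>UNIV. \<Sum>m\<in>UNIV. frame_change U c s m j * frame_change U c m s k)
      = frame_change2 U (\<lambda>a b. \<Sum>s\<in>UNIV. \<Sum>m\<in>UNIV. c s m a * c m s b) j k"
    unfolding last_first[of _ _ j] last_first'[of _ _ k] by (rule contract_frame_change[OF U])
  have 2: "(\<Sum>s\<in>UNIV. \<Sum>m\<in>UNIV. frame_change U c s m j * frame_change U c s m k)
      = frame_change2 U (\<lambda>a b. \<Sum>s\<in>UNIV. \<Sum>m\<in>UNIV. c s m a * c s m b) j k"
    unfolding last_first[of _ _ j] last_first[of _ _ k] by (rule contract_frame_change[OF U])
  \<comment> \<open>In this trace term the free indices come out as \<open>k j\<close>, so the
    bilinear form is transposed; the other trace term already has the order
    \<open>j k\<close>.\<close>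
  have 3: "(\<Sum>s\<in>UNIV. \<Sum>m\<in>UNIV. frame_change U c m m s * frame_change U c k s j)
     = frame_change2 U (\<lambda>a b. \<Sum>s\<in>UNIV. \<Sum>m\<in>UNIV. c m m s * c b s a) j k"
    unfolding contract_trace_frame_change[OF U] by (rule frame_change2_swap)
  show ?thesis
    unfolding ricci_eq_contractions frame_const_mult_orthogonal[OF assms] c_def[symmetric]
      1 2 3 contract_frame_change[OF U] contract_trace_frame_change[OF U]
    unfolding frame_change2_linear ..
qed

section \<open>The logarithmic derivative\<close>

text \<open>The left side of the flow system as one matrix. Adding the transpose removes the skew
  contribution of an orthogonal factor.\<close>

definition log_derivative_sym :: "real ^ 'n::finite ^ 'n \<Rightarrow> real ^ 'n ^ 'n \<Rightarrow> real ^ 'n ^ 'n" where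
  "log_derivative_sym P P' = matrix_inv P ** P' + transpose (matrix_inv P ** P')"

lemma ricci_flow_solution_iff:
  "ricci_flow_solution C T P \<longleftrightarrow>
     smooth_curve_in T GL P \<and>
     (\<forall>t\<in>T. log_derivative_sym (P t) (vector_derivative P (at t within T))
              = (\<chi> i j. 2 * ricci C (P t) i j))"
  by (simp add: ricci_flow_solution_def log_derivative_sym_def vec_eq_iff
      matrix_matrix_mult_def transpose_def add.commute)

lemma frame_change2_eq_matrix:
  "(\<chi> j k. frame_change2 U r j k) = transpose U ** (\<chi> a b. r a b) ** U"
proof -
  have "(\<Sum>a\<in>UNIV. U $ a $ j * (\<Sum>b\<in>UNIV. U $ b $ k * r a b))
      = (\<Sum>b\<in>UNIV. (\<Sum>a\<in>UNIV. U $ a $ j * r a b) * U $ b $ k)" for j k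
    by (subst sum_mult_swap) (simp add: mult.commute)
  then show ?thesis
    by (simp add: vec_eq_iff frame_change2_def matrix_matrix_mult_def transpose_def)
qed

section \<open>Differentiation of matrix curves\<close>

lemma bounded_bilinear_matrix_mult:
  "bounded_bilinear ((**) :: real ^ 'n::finite ^ 'm::finite \<Rightarrow> real ^ 'p::finite ^ 'n \<Rightarrow> real ^ 'p ^ 'm)"
  unfolding bilinear_conv_bounded_bilinear[symmetric] bilinear_def
  by (auto intro!: linearI simp: vec_eq_iff matrix_matrix_mult_def sum.distrib algebra_simps
      sum_distrib_left)

lemma bounded_linear_transpose:
  "bounded_linear (transpose :: real ^ 'n::finite ^ 'm::finite \<Rightarrow> real ^ 'm ^ 'n)"
  unfolding linear_conv_bounded_linear[symmetric]
  by (auto intro!: linearI simp: vec_eq_iff transpose_def)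

lemma smooth_on_has_vector_derivative:
  assumes "smooth_on T P" "t \<in> T"
  shows "(P has_vector_derivative vector_derivative P (at t within T)) (at t within T)"
proof -
  obtain D where D: "\<And>x. x \<in> T \<Longrightarrow> D [] x = P x"
    and "(D [] has_derivative (\<lambda>v. D [v] t)) (at t within T)"
    using assms unfolding smooth_on_def by blast
  then have "(P has_derivative (\<lambda>v. D [v] t)) (at t within T)"
    \<comment> \<open>\<open>D []\<close> agrees with \<open>P\<close> only on \<open>T\<close>,
      which suffices for a derivative within \<open>T\<close>.\<close>
    by (intro has_derivative_transform[OF assms(2) D[symmetric]])
  then have "P differentiable (at t within T)"
    by (rule differentiableI)
  then show ?thesis
    by (simp add: vector_derivative_works)
qed

text \<open>The product \<open>transpose (U t) ** U t\<close> is constant on \<open>T\<close>, so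
  its derivative from the product rule equals 0. Comparing the two values needs uniqueness of
  derivatives within \<open>T\<close>, hence the nontrivial filter.\<close>

lemma orthogonal_log_derivative_skew:
  fixes U :: "real \<Rightarrow> real ^ 'n::finite ^ 'n"
  assumes "at t within T \<noteq> bot" "t \<in> T" "\<And>t. t \<in> T \<Longrightarrow> orthogonal_matrix (U t)"
    and U': "(U has_vector_derivative U') (at t within T)"
  shows "transpose (U t) ** U' + transpose (transpose (U t) ** U') = 0"
proof -
  have "((\<lambda>t. transpose (U t) ** U t) has_vector_derivative
      transpose (U t) ** U' + transpose U' ** U t) (at t within T)"
    by (intro bounded_bilinear.has_vector_derivative[OF bounded_bilinear_matrix_mult] U'
        bounded_linear.has_vector_derivative[OF bounded_linear_transpose])
  moreover have "((\<lambda>t. transpose (U t) ** U t) has_vector_derivative 0) (at t within T)"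
    using assms by (intro has_vector_derivative_transform[OF _ _ has_vector_derivative_const[of "mat 1"]])
      (simp_all add: orthogonal_matrix_def)
  ultimately have "transpose (U t) ** U' + transpose U' ** U t = 0"
    using vector_derivative_unique_within[OF assms(1)] by blast
  then show ?thesis
    by (simp add: matrix_transpose_mul)
qed

text \<open>\<open>P ** U' + P' ** U\<close> is the product rule value for \<open>P ** U\<close>.
  After cancelling \<open>matrix_inv P ** P\<close>, the term with \<open>U'\<close> is
  \<open>transpose U ** U'\<close>, which symmetrizes to 0 by \<open>skew\<close>.\<close>

lemma log_derivative_sym_mult_orthogonal:
  fixes P U :: "real ^ 'n::finite ^ 'n"
  assumes "invertible P" "orthogonal_matrix U"
    and skew: "transpose U ** U' + transpose (transpose U ** U') = 0"
  shows "log_derivative_sym (P ** U) (P ** U' + P' ** U)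
       = transpose U ** log_derivative_sym P P' ** U"
proof -
  have "matrix_inv (P ** U) ** (P ** U' + P' ** U)
      = transpose U ** (matrix_inv P ** P) ** U' + transpose U ** (matrix_inv P ** P') ** U"
    by (simp add: matrix_inv_mult_orthogonal[OF assms(1,2)] matrix_add_ldistrib matrix_mul_assoc)
  then have eq: "matrix_inv (P ** U) ** (P ** U' + P' ** U)
      = transpose U ** U' + transpose U ** (matrix_inv P ** P') ** U"
    by (simp add: matrix_inv_left_inverse[OF assms(1)])
  have add: "transpose (X + Y) = transpose X + transpose Y" for X Y :: "real ^ 'n ^ 'n"
    by (simp add: vec_eq_iff transpose_def)
  have "log_derivative_sym (P ** U) (P ** U' + P' ** U)
      = (transpose U ** U' + transpose (transpose U ** U'))
        + transpose U ** log_derivative_sym P P' ** U"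
    unfolding log_derivative_sym_def eq add
    by (simp add: matrix_transpose_mul matrix_add_ldistrib matrix_mul_assoc
        bounded_bilinear.add_left[OF bounded_bilinear_matrix_mult])
  then show ?thesis
    by (simp add: skew)
qed

lemma orthogonal_conjugate_eq_iff:
  fixes U X Y :: "real ^ 'n::finite ^ 'n"
  assumes "orthogonal_matrix U"
  shows "transpose U ** X ** U = transpose U ** Y ** U \<longleftrightarrow> X = Y"
proof
  assume "transpose U ** X ** U = transpose U ** Y ** U"
  then have "U ** (transpose U ** X ** U) ** transpose U = U ** (transpose U ** Y ** U) ** transpose U"
    by simp
  moreover have "U ** (transpose U ** Z ** U) ** transpose U = Z" for Z
  proof -
    have "U ** (transpose U ** Z ** U) ** transpose U = (U ** transpose U) ** Z ** (U ** transpose U)"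
      by (simp add: matrix_mul_assoc)
    then show ?thesis
      using assms by (simp add: orthogonal_matrix_def)
  qed
  ultimately show "X = Y"
    by simp
qed simp

theorem proposition4:
  fixes A :: "('g::{t2_space, second_countable_topology}, 'n::{finite, linorder}) chart set"
    and mul :: "'g \<Rightarrow> 'g \<Rightarrow> 'g" and e :: 'g and iv :: "'g \<Rightarrow> 'g"
    and g\<^sub>0 :: "'g \<Rightarrow> (('g \<Rightarrow> real) \<Rightarrow> real) \<Rightarrow> (('g \<Rightarrow> real) \<Rightarrow> real) \<Rightarrow> real"
    and E :: "'n \<Rightarrow> 'g vfield"
    and C :: "'n \<Rightarrow> 'n \<Rightarrow> 'n \<Rightarrow> real"
    and T :: "real set"
    and Q B U :: "real \<Rightarrow> real ^ 'n::{finite, linorder} ^ 'n::{finite, linorder}"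
  assumes "lie_group A mul e iv"
    and "left_invariant_metric A mul g\<^sub>0"
    and "orthonormal_frame A mul g\<^sub>0 E"
    and "structure_constants E C"
    and "is_interval T" and "interior T \<noteq> {}"
    and "smooth_curve_in T GL Q"
    and "smooth_curve_in T UT B"
    and "smooth_curve_in T O_group U"
    and "\<And>t. t \<in> T \<Longrightarrow> Q t = B t ** U t"
  shows "ricci_flow_solution C T Q \<longleftrightarrow> ricci_flow_solution C T B"
proof -
  \<comment> \<open>The two systems are compared at each time separately.\<close>
  have "(log_derivative_sym (Q t) (vector_derivative Q (at t within T)) = (\<chi> i j. 2 * ricci C (Q t) i j))
    \<longleftrightarrow> (log_derivative_sym (B t) (vector_derivative B (at t within T)) = (\<chi> i j. 2 * ricci C (B t) i j))"
    if t: "t \<in> T" for t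
  proof -
    have "connected T"
      using \<open>is_interval T\<close> by (simp add: is_interval_connected)
    moreover have "T \<noteq> {x}" for x
      using \<open>interior T \<noteq> {}\<close> by auto
    \<comment> \<open>A connected set other than a singleton has no isolated points, so one-sided
      derivatives at end points of \<open>T\<close> are unique as well.\<close>
    ultimately have nontriv: "at t within T \<noteq> bot"
      using connected_imp_perfect t trivial_limit_within by blast
    have inv: "invertible (B t)" and U: "\<And>t. t \<in> T \<Longrightarrow> orthogonal_matrix (U t)"
      and smooth: "smooth_on T B" "smooth_on T U"
      using assms(8,9) t by (auto simp: smooth_curve_in_def UT_def O_group_def)
    define B' U' where "B' = vector_derivative B (at t within T)"
      and "U' = vector_derivative U (at t within T)"
    have B': "(B has_vector_derivative B') (at t within T)"
      and U': "(U has_vector_derivative U') (at t within T)"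
      unfolding B'_def U'_def by (intro smooth_on_has_vector_derivative smooth t)+
    have "(Q has_vector_derivative B t ** U' + B' ** U t) (at t within T)"
      by (rule has_vector_derivative_transform[OF t assms(10)])
        (auto intro: bounded_bilinear.has_vector_derivative[OF bounded_bilinear_matrix_mult] B' U')
    then have Q': "vector_derivative Q (at t within T) = B t ** U' + B' ** U t"
      by (rule vector_derivative_within[OF nontriv])
    have lhs: "log_derivative_sym (Q t) (vector_derivative Q (at t within T))
        = transpose (U t) ** log_derivative_sym (B t) B' ** U t"
      unfolding Q' assms(10)[OF t]
      by (intro log_derivative_sym_mult_orthogonal inv U t
          orthogonal_log_derivative_skew[OF nontriv t _ U'])
    \<comment> \<open>Linearity absorbs the factor 2 into the bilinear form, so both sides of the
      equation for \<open>Q\<close> are conjugates by the same \<open>U t\<close>, which can be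
      cancelled.\<close>
    have rhs: "(\<chi> i j. 2 * ricci C (Q t) i j)
        = transpose (U t) ** (\<chi> i j. 2 * ricci C (B t) i j) ** U t"
      unfolding assms(10)[OF t] ricci_mult_orthogonal[OF inv U[OF t]]
        frame_change2_linear frame_change2_eq_matrix ..
    show ?thesis
      unfolding lhs rhs orthogonal_conjugate_eq_iff[OF U[OF t]] B'_def ..
  qed
  moreover have "smooth_curve_in T GL B"
    using assms(8) by (auto simp: smooth_curve_in_def UT_def GL_def)
  ultimately show ?thesis
    using assms(7) unfolding ricci_flow_solution_iff by blast
qed

end
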